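(* Let $M\ge 4N-2$. For generic range $R_S$ the following holds. Let $S\in\mathbb{C}^{M\times N}$ be a frame matrix with range $R_S$, let $\psi_0\in\mathbb{C}^N$ be such that $a:=|S\psi_0|$ has all entries nonzero, and let $U$ be an open neighborhood of $S_a:=\{e^{it}S\psi_0:\ t\in[0,2\pi)\}$ with $U\cap\Theta_{a,0}^{\mathrm{AP}}=S_a$, where $\Theta_{a,0}^{\mathrm{AP}}:=\{\zeta\in R_S:\ P_SP_a\zeta=\zeta\}$. Let $\zeta^{(0)}\in U$, and define $\zeta^{(l+1/2)}:=P_a\zeta^{(l)}$ and $\zeta^{(l+1)}:=P_S\zeta^{(l+1/2)}$ for $l=0,1,2,\dots$. Then the following three conditions are equivalent: (1) the sequence $(\zeta^{(l)})$ converges to the solution set $S_a$ as $l\to\infty$; (2) $\|(P_a-I)\zeta^{(l)}\|\to 0$ as $l\to\infty$; (3) $\|(P_S-I)\zeta^{(l+1/2)}\|\to 0$ as $l\to\infty$. Moreover, these conditions imply (4) $\|\zeta^{(l+1)}-\zeta^{(l)}\|\to 0$ as $l\to\infty$.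
   Context: $M\ge N\ge 1$ are integers. A frame is a family $f_1,\dots,f_M\in\mathbb{C}^N$ spanning $\mathbb{C}^N$; its matrix $S\in\mathbb{C}^{M\times N}$ has $i$-th row $f_i^*$. $R_S\subset\mathbb{C}^M$ denotes the range (column space) of $S$, a complex $N$-dimensional subspace. For a vector $u$, $|u|$ is the vector of entrywise moduli, and $\|\cdot\|$ is the Euclidean norm. Phase correction operator: $P_S:=S(S^*S)^{-1}S^*$, the orthogonal projection of $\mathbb{C}^M$ onto $R_S$. Amplitude correction operator: for $a\in\mathbb{R}_+^M$ (nonnegative entries), $P_a:\mathbb{C}^M\to\mathbb{C}^M$ is defined entrywise by $(P_az)(i)=a(i)\,z(i)/|z(i)|$ if $z(i)\ne 0$ and $(P_az)(i)=a(i)$ if $z(i)=0$. The iteration in the claim is the alternating projection (AP) algorithm. Convergence to the set $S_a$ means $\inf_{w\in S_a}\|\zeta^{(l)}-w\|\to 0$. "For generic $R_S$" means: there is a non-empty Zariski open set in the Grassmannian $\mathrm{Gr}(N,M;\mathbb{C})$ of complex $N$-dimensional subspaces of $\mathbb{C}^M$, regarded as a real algebraic variety, such that the statement holds for all frames whose range lies in this set. *)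

theory Defs
  imports "HOL-Analysis.Analysis"
begin

text \<open>
  Throughout, \<open>N = CARD('n)\<close> and \<open>M = CARD('m)\<close>; an \<open>M \<times> N\<close> complex matrix has type
  \<open>complex^'n^'m\<close>. The notions \<open>vec.span\<close>, \<open>vec.subspace\<close> and \<open>vec.dim\<close> are the complex-linear ones
  (the unqualified \<open>span\<close>, \<open>subspace\<close>, \<open>dim\<close> would be real-linear).
\<close>

definition frame :: "('m::finite \<Rightarrow> complex^'n) \<Rightarrow> bool" where
  "frame f \<longleftrightarrow> vec.span (range f) = UNIV"

definition frame_matrix :: "complex^'n^'m \<Rightarrow> bool" where
  "frame_matrix S \<longleftrightarrow> (\<exists>f. frame f \<and> S = (\<chi> i j. cnj (f i $ j)))"

definition matrix_range :: "complex^'n^'m \<Rightarrow> (complex^'m) set" where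
  "matrix_range S = range (\<lambda>\<psi>. S *v \<psi>)"

definition ctranspose :: "complex^'n^'m \<Rightarrow> complex^'m^'n" where
  "ctranspose S = (\<chi> i j. cnj (S $ j $ i))"

definition phase_corr :: "complex^'n^'m \<Rightarrow> complex^'m \<Rightarrow> complex^'m" where
  "phase_corr S z = (S ** matrix_inv (ctranspose S ** S) ** ctranspose S) *v z"

definition amp_corr :: "real^'m \<Rightarrow> complex^'m \<Rightarrow> complex^'m" where
  "amp_corr a z =
     (\<chi> i. if z $ i \<noteq> 0 then of_real (a $ i) * (z $ i / of_real (cmod (z $ i)))
          else of_real (a $ i))"

definition cmod_vec :: "complex^'m \<Rightarrow> real^'m" where
  "cmod_vec u = (\<chi> i. cmod (u $ i))"

definition solution_set :: "complex^'n^'m \<Rightarrow> complex^'n \<Rightarrow> (complex^'m) set" where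
  "solution_set S \<psi>\<^sub>0 = {cis t *s (S *v \<psi>\<^sub>0) | t. 0 \<le> t \<and> t < 2 * pi}"

definition AP_fixed_points :: "complex^'n^'m \<Rightarrow> real^'m \<Rightarrow> (complex^'m) set" where
  "AP_fixed_points S a = {\<zeta> \<in> matrix_range S. phase_corr S (amp_corr a \<zeta>) = \<zeta>}"

definition grassmannian :: "'n::finite itself \<Rightarrow> (complex^'m) set set" where
  "grassmannian _ = {V. vec.subspace V \<and> vec.dim V = CARD('n)}"

text \<open>
  An injective \<open>\<sigma> :: 'n \<Rightarrow> 'm\<close> selects \<open>N\<close> of the \<open>M\<close> coordinates. The corresponding standard
  affine chart of the Grassmannian consists of the subspaces projecting isomorphically onto these
  coordinates; \<open>S \<mapsto> matrix_range S\<close> is a bijection onto it from the affine space of matrices whose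
  rows selected by \<open>\<sigma>\<close> form the identity matrix (the other \<open>M - N\<close> rows are the free coordinates).
\<close>

definition chart_domain :: "('n::finite \<Rightarrow> 'm::finite) \<Rightarrow> (complex^'n^'m) set" where
  "chart_domain \<sigma> = {S. \<forall>i j. S $ \<sigma> i $ j = (if i = j then 1 else 0)}"

text \<open>
  Zariski topology of the Grassmannian as a \<^emph>\<open>real\<close> algebraic variety: a set is open iff its
  trace on every standard chart is the complement of the common zero set of a family of real
  polynomials. Since \<open>real_polynomial_function\<close> is generated by constants and real-linear
  functionals, on matrices these are exactly the real polynomials in the real and imaginary parts
  of the entries.
\<close>

definition zariski_open :: "'n::finite itself \<Rightarrow> (complex^'m) set set \<Rightarrow> bool" where
  "zariski_open T W \<longleftrightarrow>
     W \<subseteq> grassmannian T \<and>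
     (\<forall>\<sigma> :: 'n \<Rightarrow> 'm. inj \<sigma> \<longrightarrow>
        (\<exists>Q :: (complex^'n^'m \<Rightarrow> real) set.
           (\<forall>q\<in>Q. real_polynomial_function q) \<and>
           (\<forall>S\<in>chart_domain \<sigma>. matrix_range S \<in> W \<longleftrightarrow> (\<exists>q\<in>Q. q S \<noteq> 0))))"

end

theory Submission
  imports Defs
begin

text \<open>
  Two facts make the theorem true.

  For generic ranges the moduli of a vector in the range determine it up to a phase
  (\<open>phase_retrieval\<close>). A bad matrix \<open>S\<close> has independent \<open>x\<close>, \<open>y\<close> with
  \<open>\<bar>S x\<bar> = \<bar>S y\<bar>\<close>, that is, every row of \<open>S\<close> is orthogonal to \<open>y - w x\<close> for some phase
  \<open>w\<close> belonging to the row. After normalization \<open>x\<close> and \<open>y\<close> have \<open>4 N - 3\<close> real parameters.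
  Each row then has one phase and \<open>N - 1\<close> free complex entries, one real parameter less than an
  arbitrary row. So for \<open>M > 4 N - 3\<close> the bad matrices are covered by images of finitely many
  rational maps with fewer parameters than there are coordinates
  (\<open>ambiguous_parametrization\<close>, \<open>card_free_params\<close>). A count of monomials shows that
  some nonzero polynomial vanishes on such images (\<open>polynomial_vanishing_on_rational_images\<close>), hence
  on all bad matrices. Being bad depends on the range only, so the ranges of the matrices on which
  this polynomial is nonzero form a nonempty Zariski open set of good subspaces
  (\<open>zariski_open_nonvanishing\<close>).

  For a good range the equivalences are elementary estimates
  (\<open>alternating_projection_conditions\<close>): the distance from \<open>z\<close> to its amplitude correction is the
  distance from \<open>z\<close> to the set of all vectors with moduli \<open>a\<close>, and a bounded sequence in the range
  whose moduli tend to \<open>a\<close> can accumulate only at solutions.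
\<close>

section \<open>Images of rational maps lie in hypersurfaces\<close>

text \<open>
  Gaussian elimination: an equation with a nonzero coefficient at \<open>e0\<close> is used to eliminate the
  unknown \<open>e0\<close> from the others, which costs one equation and one unknown.
\<close>
lemma homogeneous_system_nontrivial_solution:
  fixes a :: "'q \<Rightarrow> 'e \<Rightarrow> 'f::field"
  assumes "finite Q" "finite E" "card Q < card E"
  shows "\<exists>c. (\<exists>e\<in>E. c e \<noteq> 0) \<and> (\<forall>q\<in>Q. (\<Sum>e\<in>E. a q e * c e) = 0)"
  using assms
proof (induction Q arbitrary: E a rule: finite_induct)
  case empty
  then have "E \<noteq> {}" by auto
  then show ?case by (auto intro!: exI[of _ "\<lambda>_. 1"])
next
  case (insert q0 Q)
  show ?case
  proof (cases "\<forall>e\<in>E. a q0 e = 0")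
    case True
    have "card Q < card E" using insert by simp
    from insert.IH[OF insert.prems(1) this, of a] True show ?thesis by auto
  next
    case False
    then obtain e0 where e0: "e0 \<in> E" "a q0 e0 \<noteq> 0" by blast
    let ?E = "E - {e0}"
    have "card Q < card ?E" using insert e0 by simp
    from insert.IH[OF _ this, of "\<lambda>q e. a q e - a q e0 * a q0 e / a q0 e0"] insert.prems
    obtain c where c: "\<exists>e\<in>?E. c e \<noteq> 0"
      "\<And>q. q \<in> Q \<Longrightarrow> (\<Sum>e\<in>?E. (a q e - a q e0 * a q0 e / a q0 e0) * c e) = 0" by auto
    define r where "r = (\<Sum>e\<in>?E. a q0 e * c e)"
    define c' where "c' = c(e0 := - r / a q0 e0)"
    have split: "(\<Sum>e\<in>E. a q e * c' e) = a q e0 * (- r / a q0 e0) + (\<Sum>e\<in>?E. a q e * c e)" for q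
    proof -
      have "(\<Sum>e\<in>?E. a q e * c' e) = (\<Sum>e\<in>?E. a q e * c e)"
        by (rule sum.cong) (auto simp: c'_def)
      then show ?thesis using sum.remove[OF insert.prems(1) e0(1), of "\<lambda>e. a q e * c' e"]
        by (simp add: c'_def)
    qed
    have "(\<Sum>e\<in>E. a q0 e * c' e) = 0" using e0 by (simp add: split r_def)
    moreover have "(\<Sum>e\<in>E. a q e * c' e) = 0" if "q \<in> Q" for q
    proof -
      have "(\<Sum>e\<in>?E. (a q e - a q e0 * a q0 e / a q0 e0) * c e)
          = (\<Sum>e\<in>?E. a q e * c e) - (\<Sum>e\<in>?E. a q e0 / a q0 e0 * (a q0 e * c e))"
        by (simp add: sum_subtractf[symmetric] algebra_simps)
      also have "\<dots> = (\<Sum>e\<in>?E. a q e * c e) - a q e0 / a q0 e0 * r"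
        by (simp add: r_def sum_distrib_left)
      finally show ?thesis using c(2)[OF that] by (simp add: split)
    qed
    moreover have "\<exists>e\<in>E. c' e \<noteq> 0" using c(1) by (auto simp: c'_def)
    ultimately show ?thesis by blast
  qed
qed

text \<open>
  Polynomial functions in the variables \<open>K\<close> of degree at most \<open>L\<close> in each variable separately.
  Bounding the degrees one variable at a time makes the number of monomials the plain power
  \<open>(L + 1) ^ card K\<close>, which is all that the dimension count below needs.
\<close>
inductive poly_deg :: "'k set \<Rightarrow> nat \<Rightarrow> (('k \<Rightarrow> complex) \<Rightarrow> complex) \<Rightarrow> bool"
  for K :: "'k set" and L :: nat where
  monomial: "(\<And>k. k \<in> K \<Longrightarrow> m k \<le> L) \<Longrightarrow> poly_deg K L (\<lambda>z. c * (\<Prod>k\<in>K. z k ^ m k))"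
| add: "poly_deg K L f \<Longrightarrow> poly_deg K L g \<Longrightarrow> poly_deg K L (\<lambda>z. f z + g z)"

lemma poly_deg_mono:
  assumes "poly_deg K L f" "L \<le> L'" shows "poly_deg K L' f"
  using assms(1)
proof induction
  case (monomial m c)
  with assms(2) show ?case by (intro poly_deg.monomial) (meson order_trans)
qed (rule poly_deg.add)

lemma poly_deg_const: "poly_deg K L (\<lambda>z. c)"
  using poly_deg.monomial[of K "\<lambda>_. 0" L c] by simp

lemma poly_deg_var:
  assumes "finite K" "k \<in> K" shows "poly_deg K 1 (\<lambda>z. z k)"
proof -
  have "(\<lambda>z::'a \<Rightarrow> complex. z k) = (\<lambda>z. 1 * (\<Prod>i\<in>K. z i ^ (if i = k then 1 else 0)))"
  proof
    fix z :: "'a \<Rightarrow> complex"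
    have "(\<Prod>i\<in>K. z i ^ (if i = k then 1 else 0)) = (\<Prod>i\<in>K. if i = k then z i else 1)"
      by (rule prod.cong) auto
    then show "z k = 1 * (\<Prod>i\<in>K. z i ^ (if i = k then 1 else 0))" using assms by simp
  qed
  then show ?thesis using poly_deg.monomial[of K "\<lambda>i. if i = k then 1 else 0" 1 1] by simp
qed

lemma poly_deg_mult:
  assumes "poly_deg K L f" "poly_deg K L' g"
  shows "poly_deg K (L + L') (\<lambda>z. f z * g z)"
  using assms(1)
proof induction
  case (monomial m c)
  from assms(2) show ?case
  proof induction
    case (monomial m' c')
    have "(\<lambda>z. c * (\<Prod>k\<in>K. z k ^ m k) * (c' * (\<Prod>k\<in>K. z k ^ m' k)))
        = (\<lambda>z. (c * c') * (\<Prod>k\<in>K. z k ^ (m k + m' k)))"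
      by (simp add: fun_eq_iff power_add prod.distrib)
    moreover have "poly_deg K (L + L') (\<lambda>z. (c * c') * (\<Prod>k\<in>K. z k ^ (m k + m' k)))"
      by (rule poly_deg.monomial) (simp add: add_mono \<open>\<And>k. k \<in> K \<Longrightarrow> m k \<le> L\<close> monomial)
    ultimately show ?case by simp
    next
    case (add g h)
    from poly_deg.add[OF add.IH] show ?case by (simp add: distrib_left)
  qed
next
  case (add f h)
  from poly_deg.add[OF add.IH] show ?case by (simp add: distrib_right)
qed

lemma poly_deg_power: "poly_deg K L f \<Longrightarrow> poly_deg K (n * L) (\<lambda>z. f z ^ n)"
  by (induction n) (auto intro: poly_deg_const dest: poly_deg_mult)

lemma poly_deg_prod:
  assumes "finite A" "\<And>i. i \<in> A \<Longrightarrow> poly_deg K L (f i)"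
  shows "poly_deg K (card A * L) (\<lambda>z. \<Prod>i\<in>A. f i z)"
  using assms
proof (induction A)
  case empty
  show ?case by (simp add: poly_deg_const)
next
  case (insert i A)
  then show ?case using poly_deg_mult[of K L "f i" "card A * L"] by simp
qed

lemma poly_deg_coefficients:
  assumes "finite K" "poly_deg K L f"
  shows "\<exists>a. \<forall>z. f z = (\<Sum>m\<in>K \<rightarrow>\<^sub>E {..L}. a m * (\<Prod>k\<in>K. z k ^ m k))"
  using assms(2)
proof induction
  case (monomial m c)
  define m' where "m' = restrict m K"
  have "m' \<in> K \<rightarrow>\<^sub>E {..L}" using monomial by (auto simp: m'_def)
  moreover have "finite (K \<rightarrow>\<^sub>E {..L})" using assms(1) by (intro finite_PiE) auto
  ultimately have "(\<Sum>e\<in>K \<rightarrow>\<^sub>E {..L}. (if e = m' then c else 0) * (\<Prod>k\<in>K. z k ^ e k))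
     = c * (\<Prod>k\<in>K. z k ^ m' k)" for z :: "'a \<Rightarrow> complex"
    by (simp add: if_distrib[of "\<lambda>x. x * _"] cong: if_cong)
  moreover have "(\<Prod>k\<in>K. z k ^ m' k) = (\<Prod>k\<in>K. z k ^ m k)" for z :: "'a \<Rightarrow> complex"
    by (rule prod.cong) (auto simp: m'_def)
  ultimately show ?case by (intro exI[of _ "\<lambda>e. if e = m' then c else 0"]) simp
next
  case (add f g)
  then obtain a b where "\<And>z. f z = (\<Sum>m\<in>K \<rightarrow>\<^sub>E {..L}. a m * (\<Prod>k\<in>K. z k ^ m k))"
    "\<And>z. g z = (\<Sum>m\<in>K \<rightarrow>\<^sub>E {..L}. b m * (\<Prod>k\<in>K. z k ^ m k))" by blast
  then show ?case
    by (intro exI[of _ "\<lambda>m. a m + b m"]) (simp add: distrib_right sum.distrib)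
qed

definition poly_on :: "'k set \<Rightarrow> (('k \<Rightarrow> complex) \<Rightarrow> complex) \<Rightarrow> bool" where
  "poly_on K f \<longleftrightarrow> (\<exists>L. poly_deg K L f)"

lemma poly_on_const [simp]: "poly_on K (\<lambda>z. c)"
  unfolding poly_on_def by (blast intro: poly_deg_const)

lemma poly_on_var: "finite K \<Longrightarrow> k \<in> K \<Longrightarrow> poly_on K (\<lambda>z. z k)"
  unfolding poly_on_def by (rule exI, rule poly_deg_var)

lemma poly_on_add:
  assumes "poly_on K f" "poly_on K g" shows "poly_on K (\<lambda>z. f z + g z)"
proof -
  from assms obtain L L' where "poly_deg K L f" "poly_deg K L' g" by (auto simp: poly_on_def)
  then have "poly_deg K (max L L') f" "poly_deg K (max L L') g"
    by (auto elim: poly_deg_mono)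
  then show ?thesis unfolding poly_on_def by (blast intro: poly_deg.add)
qed

lemma poly_on_mult: "poly_on K f \<Longrightarrow> poly_on K g \<Longrightarrow> poly_on K (\<lambda>z. f z * g z)"
  unfolding poly_on_def by (blast intro: poly_deg_mult)

lemma poly_on_minus: "poly_on K f \<Longrightarrow> poly_on K (\<lambda>z. - f z)"
  using poly_on_mult[OF poly_on_const[of K "-1"]] by simp

lemma poly_on_diff: "poly_on K f \<Longrightarrow> poly_on K g \<Longrightarrow> poly_on K (\<lambda>z. f z - g z)"
  using poly_on_add[OF _ poly_on_minus] by simp

lemma poly_on_sum:
  assumes "\<And>i. i \<in> A \<Longrightarrow> poly_on K (f i)" shows "poly_on K (\<lambda>z. \<Sum>i\<in>A. f i z)"
  using assms by (induction A rule: infinite_finite_induct) (auto intro: poly_on_add)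

text \<open>
  A rational map into a space with more coordinates than the map has parameters has its image in a
  hypersurface, and so has a finite union of such images. This is a dimension count. There are
  \<open>D ^ n\<close> monomials in the \<open>n\<close> coordinates with exponents below \<open>D\<close>. After substitution of
  \<open>f i / g i\<close> and multiplication by the \<open>D\<close>-th powers of all denominators they become polynomials
  in at most \<open>n - 1\<close> parameters of degree proportional to \<open>D\<close>, which have only
  \<open>O(D ^ (n - 1))\<close> coefficients. For large \<open>D\<close> a nontrivial combination of the monomials therefore
  has all these coefficients zero, on all the images simultaneously.
\<close>
lemma polynomial_vanishing_on_rational_images:
  fixes f g :: "'j \<Rightarrow> 'i::finite \<Rightarrow> ('k \<Rightarrow> complex) \<Rightarrow> complex" and K :: "'j \<Rightarrow> 'k set"
  assumes "finite J" and finK: "\<And>j. j \<in> J \<Longrightarrow> finite (K j)"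
    and card: "\<And>j. j \<in> J \<Longrightarrow> card (K j) < CARD('i)"
    and pf: "\<And>j i. j \<in> J \<Longrightarrow> poly_on (K j) (f j i)"
    and pg: "\<And>j i. j \<in> J \<Longrightarrow> poly_on (K j) (g j i)"
  shows "\<exists>D c. (\<exists>e\<in>UNIV \<rightarrow>\<^sub>E {..<D}. c e \<noteq> 0) \<and>
    (\<forall>j\<in>J. \<forall>z \<phi>. (\<forall>i. g j i z \<noteq> 0 \<and> g j i z * \<phi> i = f j i z) \<longrightarrow>
       (\<Sum>e\<in>UNIV \<rightarrow>\<^sub>E {..<D}. c e * (\<Prod>i\<in>UNIV. \<phi> i ^ e i)) = 0)"
proof -
  obtain \<kappa> where \<kappa>: "\<And>j i. j \<in> J \<Longrightarrow> poly_deg (K j) \<kappa> (f j i)"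
    "\<And>j i. j \<in> J \<Longrightarrow> poly_deg (K j) \<kappa> (g j i)"
  proof -
    obtain Lf Lg where L: "\<And>j i. j \<in> J \<Longrightarrow> poly_deg (K j) (Lf j i) (f j i)"
      "\<And>j i. j \<in> J \<Longrightarrow> poly_deg (K j) (Lg j i) (g j i)"
      using pf pg unfolding poly_on_def by metis
    define \<kappa> where "\<kappa> = (\<Sum>j\<in>J. \<Sum>i\<in>UNIV. Lf j i + Lg j i)"
    have "Lf j i + Lg j i \<le> \<kappa>" if "j \<in> J" for j i
    proof -
      have "Lf j i + Lg j i \<le> (\<Sum>i\<in>UNIV. Lf j i + Lg j i)" by (rule member_le_sum) auto
      also have "\<dots> \<le> \<kappa>" unfolding \<kappa>_def using that \<open>finite J\<close>
        by (intro member_le_sum[where f = "\<lambda>j. \<Sum>i\<in>UNIV. Lf j i + Lg j i"]) auto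
      finally show ?thesis .
    qed
    then have "Lf j i \<le> \<kappa>" "Lg j i \<le> \<kappa>" if "j \<in> J" for j i
      using that by (meson add_leD1 add_leD2)+
    then show ?thesis by (intro that[of \<kappa>] poly_deg_mono[OF L(1)] poly_deg_mono[OF L(2)])
  qed
  define n where "n = CARD('i)"
  \<comment> \<open>The conditions number at most \<open>C * D ^ (n - 1)\<close>, so any \<open>D > C\<close> is large enough.\<close>
  define C where "C = card J * (2 * n * \<kappa> + 1) ^ (n - 1)"
  define D where "D = C + 1"
  define L where "L = n * (2 * (D * \<kappa>))"
  define E :: "('i \<Rightarrow> nat) set" where "E = UNIV \<rightarrow>\<^sub>E {..<D}"
  define Mon where "Mon j = K j \<rightarrow>\<^sub>E {..L}" for j
  define F where "F j e z = (\<Prod>i\<in>UNIV. f j i z ^ e i * g j i z ^ (D - e i))" for j e z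
  have n: "n > 0" by (simp add: n_def)
  have "finite E" "card E = D ^ n"
    by (auto simp: E_def n_def card_PiE intro!: finite_PiE)
  have finMon: "finite (Mon j)" if "j \<in> J" for j
    unfolding Mon_def using finK[OF that] by (intro finite_PiE) auto
  have "card (Sigma J Mon) < card E"
  proof -
    have "card (Sigma J Mon) = (\<Sum>j\<in>J. card (Mon j))"
      using \<open>finite J\<close> finMon by simp
    also have "\<dots> \<le> (\<Sum>j\<in>J. (L + 1) ^ (n - 1))"
    proof (rule sum_mono)
      fix j assume j: "j \<in> J"
      have "card (Mon j) = (L + 1) ^ card (K j)" using finK[OF j] by (simp add: Mon_def card_PiE)
      also have "\<dots> \<le> (L + 1) ^ (n - 1)" using card[OF j] by (intro power_increasing) (auto simp: n_def)
      finally show "card (Mon j) \<le> (L + 1) ^ (n - 1)" .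
    qed
    also have "\<dots> = card J * (L + 1) ^ (n - 1)" by simp
    also have "\<dots> \<le> card J * ((2 * n * \<kappa> + 1) * D) ^ (n - 1)"
      by (intro mult_left_mono power_mono) (auto simp: L_def D_def algebra_simps)
    also have "\<dots> = C * D ^ (n - 1)" by (simp only: C_def power_mult_distrib mult.assoc)
    also have "\<dots> < D * D ^ (n - 1)" by (simp add: D_def)
    also have "\<dots> = D ^ n" using n by (cases n) auto
    finally show ?thesis using \<open>card E = D ^ n\<close> by simp
  qed
  have "poly_deg (K j) L (F j e)" if j: "j \<in> J" and e: "e \<in> E" for j e
  proof -
    have "poly_deg (K j) (2 * (D * \<kappa>)) (\<lambda>z. f j i z ^ e i * g j i z ^ (D - e i))" for i
    proof -
      have "e i < D" using e by (auto simp: E_def)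
      then have "e i * \<kappa> + (D - e i) * \<kappa> \<le> 2 * (D * \<kappa>)"
        by (simp add: add_mult_distrib[symmetric])
      then show ?thesis
        by (rule poly_deg_mono[rotated])
          (intro poly_deg_mult poly_deg_power \<kappa> j)
    qed
    then show ?thesis unfolding F_def L_def n_def by (intro poly_deg_prod) auto
  qed
  then have "\<exists>a. \<forall>z. F j e z = (\<Sum>m\<in>Mon j. a m * (\<Prod>k\<in>K j. z k ^ m k))" if "j \<in> J" "e \<in> E" for j e
    using poly_deg_coefficients[of "K j" L "F j e"] finK that unfolding Mon_def by blast
  then obtain a where a: "\<And>j e z. j \<in> J \<Longrightarrow> e \<in> E \<Longrightarrow>
     F j e z = (\<Sum>m\<in>Mon j. a j e m * (\<Prod>k\<in>K j. z k ^ m k))" by metis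
  have "finite (Sigma J Mon)" using \<open>finite J\<close> finMon by auto
  \<comment> \<open>One equation for each image \<open>j\<close> and each monomial \<open>m\<close> in its parameters.\<close>
  from homogeneous_system_nontrivial_solution[OF this \<open>finite E\<close> \<open>card (Sigma J Mon) < card E\<close>,
      of "\<lambda>(j, m) e. a j e m"]
  obtain c where c: "\<exists>e\<in>E. c e \<noteq> 0"
    and c0: "\<And>j m. j \<in> J \<Longrightarrow> m \<in> Mon j \<Longrightarrow> (\<Sum>e\<in>E. a j e m * c e) = 0" by auto
  have "(\<Sum>e\<in>E. c e * (\<Prod>i\<in>UNIV. \<phi> i ^ e i)) = 0"
    if j: "j \<in> J" and \<phi>: "\<forall>i. g j i z \<noteq> 0 \<and> g j i z * \<phi> i = f j i z" for j z \<phi>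
  proof -
    define G where "G = (\<Prod>i\<in>UNIV. g j i z ^ D)"
    have G: "G * (\<Prod>i\<in>UNIV. \<phi> i ^ e i) = F j e z" if e: "e \<in> E" for e
    proof -
      have "g j i z ^ D * \<phi> i ^ e i = f j i z ^ e i * g j i z ^ (D - e i)" for i
      proof -
        have "e i < D" using e by (auto simp: E_def)
        then have "g j i z ^ D = g j i z ^ e i * g j i z ^ (D - e i)"
          by (simp add: power_add[symmetric])
        then have "g j i z ^ D * \<phi> i ^ e i = (g j i z * \<phi> i) ^ e i * g j i z ^ (D - e i)"
          by (simp add: power_mult_distrib)
        then show ?thesis using \<phi> by simp
      qed
      then show ?thesis by (simp add: G_def F_def prod.distrib[symmetric])
    qed
    have "G * (\<Sum>e\<in>E. c e * (\<Prod>i\<in>UNIV. \<phi> i ^ e i)) = (\<Sum>e\<in>E. c e * F j e z)"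
      unfolding sum_distrib_left by (rule sum.cong) (simp_all add: G[symmetric])
    also have "\<dots> = (\<Sum>e\<in>E. \<Sum>m\<in>Mon j. (\<Prod>k\<in>K j. z k ^ m k) * (a j e m * c e))"
      by (rule sum.cong) (simp_all add: a[OF j] sum_distrib_left mult_ac)
    also have "\<dots> = (\<Sum>m\<in>Mon j. (\<Prod>k\<in>K j. z k ^ m k) * (\<Sum>e\<in>E. a j e m * c e))"
      by (subst sum.swap) (simp add: sum_distrib_left)
    also have "\<dots> = 0" using c0[OF j] by simp
    finally show ?thesis using \<phi> by (auto simp: G_def)
  qed
  then show ?thesis using c unfolding E_def by blast
qed

text \<open>
  The exponent vectors in \<open>E\<close> are only required to differ on \<open>A\<close>; this is what the induction
  over the variables preserves. Collecting the powers of one variable gives a univariate polynomial,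
  one of whose coefficients is nonzero for a suitable choice of the remaining variables.
\<close>
lemma nonzero_polynomial_has_nonzero_value:
  fixes c :: "('i \<Rightarrow> nat) \<Rightarrow> real"
  assumes "finite A" "finite E" "inj_on (\<lambda>e. restrict e A) E" "e0 \<in> E" "c e0 \<noteq> 0"
  shows "\<exists>r. (\<Sum>e\<in>E. c e * (\<Prod>i\<in>A. r i ^ e i)) \<noteq> 0"
  using assms
proof (induction A arbitrary: E rule: finite_induct)
  case empty
  then have "E = {e0}" by (auto simp: inj_on_def restrict_def)
  then show ?case using empty by simp
next
  case (insert i A)
  define E' where "E' n = {e\<in>E. e i = n}" for n
  define B where "B = Max ((\<lambda>e. e i) ` E)"
  have B: "e i \<le> B" if "e \<in> E" for e using that insert.prems by (simp add: B_def)
  have "inj_on (\<lambda>e. restrict e A) (E' (e0 i))"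
  proof (rule inj_onI)
    fix e e' assume *: "e \<in> E' (e0 i)" "e' \<in> E' (e0 i)" "restrict e A = restrict e' A"
    then have "e k = e' k" if "k \<in> A" for k using that by (metis restrict_apply')
    then have "restrict e (insert i A) = restrict e' (insert i A)"
      using * by (auto simp: fun_eq_iff restrict_def E'_def)
    moreover have "e \<in> E" "e' \<in> E" using * by (auto simp: E'_def)
    ultimately show "e = e'" by (rule inj_onD[OF insert.prems(2)])
  qed
  moreover have "finite (E' (e0 i))" "e0 \<in> E' (e0 i)" using insert.prems by (auto simp: E'_def)
  ultimately obtain r where r: "(\<Sum>e\<in>E' (e0 i). c e * (\<Prod>k\<in>A. r k ^ e k)) \<noteq> 0"
    using insert.IH insert.prems(4) by blast
  define d where "d n = (\<Sum>e\<in>E' n. c e * (\<Prod>k\<in>A. r k ^ e k))" for n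
  have expand: "(\<Sum>e\<in>E. c e * (\<Prod>k\<in>insert i A. (r(i := t)) k ^ e k)) = (\<Sum>n\<le>B. d n * t ^ n)" for t
  proof -
    have "(\<Prod>k\<in>insert i A. (r(i := t)) k ^ e k) = t ^ e i * (\<Prod>k\<in>A. r k ^ e k)" for e
    proof -
      have "(\<Prod>k\<in>A. (r(i := t)) k ^ e k) = (\<Prod>k\<in>A. r k ^ e k)"
        using insert.hyps by (intro prod.cong) auto
      then show ?thesis using insert.hyps by simp
    qed
    then have "(\<Sum>e\<in>E. c e * (\<Prod>k\<in>insert i A. (r(i := t)) k ^ e k))
        = (\<Sum>e\<in>E. c e * (t ^ e i * (\<Prod>k\<in>A. r k ^ e k)))" by simp
    also have "\<dots> = (\<Sum>n\<le>B. \<Sum>e\<in>{e\<in>E. e i = n}. c e * (t ^ e i * (\<Prod>k\<in>A. r k ^ e k)))"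
      using B insert.prems(1) by (intro sum.group[symmetric]) auto
    also have "\<dots> = (\<Sum>n\<le>B. d n * t ^ n)"
      by (auto simp: d_def E'_def sum_distrib_right intro!: sum.cong)
    finally show ?thesis .
  qed
  have "\<exists>t. (\<Sum>n\<le>B. d n * t ^ n) \<noteq> 0"
  proof (rule ccontr)
    assume "\<not> ?thesis"
    then have "d (e0 i) = 0" using polyfun_eq_0[of d B] B insert.prems by blast
    then show False using r by (simp add: d_def)
  qed
  then show ?case using expand by metis
qed

section \<open>Matrices without phase retrieval\<close>

text \<open>
  The inequality says that \<open>x\<close> and \<open>y\<close> are linearly independent: the moduli of the coordinates
  in the range of \<open>S\<close> fail to determine a vector even up to a complex factor.
\<close>
definition ambiguous :: "complex^'n^'m \<Rightarrow> bool" where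
  "ambiguous S \<longleftrightarrow> (\<exists>x y p s. x $ p * y $ s \<noteq> x $ s * y $ p \<and>
     (\<forall>i. cmod ((S *v x) $ i) = cmod ((S *v y) $ i)))"

text \<open>
  Both vectors may be scaled by a common positive number and by separate phases without disturbing
  the moduli. This uses up three real parameters: \<open>x $ p = 1\<close> and \<open>y $ p\<close> real.
\<close>
lemma ambiguous_normal_form:
  assumes "ambiguous (S :: complex^'n^'m)"
  obtains x y p s where "x $ p = 1" "y $ p \<in> \<real>" "y $ s \<noteq> y $ p * x $ s"
    "\<And>i. cmod ((S *v x) $ i) = cmod ((S *v y) $ i)"
proof -
  obtain x y p s where 1: "x $ p * y $ s \<noteq> x $ s * y $ p"
    and S: "\<And>i. cmod ((S *v x) $ i) = cmod ((S *v y) $ i)"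
    using assms unfolding ambiguous_def by blast
  have "\<exists>p s. x $ p \<noteq> 0 \<and> x $ p * y $ s \<noteq> x $ s * y $ p"
    using 1 by (metis mult_zero_left)
  then obtain p s where ps: "x $ p \<noteq> 0" "x $ p * y $ s \<noteq> x $ s * y $ p" by blast
  obtain u where u: "cmod u = 1" "u * y $ p \<in> \<real>"
  proof (cases "y $ p = 0")
    case True then show ?thesis using that[of 1] by simp
  next
    case False
    have "cnj (y $ p) / of_real (cmod (y $ p)) * y $ p = (y $ p * cnj (y $ p)) / of_real (cmod (y $ p))"
      by simp
    also have "\<dots> \<in> \<real>" by (simp only: complex_mult_cnj) auto
    finally show ?thesis using that[of "cnj (y $ p) / of_real (cmod (y $ p))"] False
      by (simp add: norm_divide)
  qed
  \<comment> \<open>\<open>x\<close> is divided by \<open>x $ p\<close>, so \<open>y\<close> has to be divided by a number of the same modulus.\<close>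
  define \<nu> where "\<nu> = u / of_real (cmod (x $ p))"
  have "u \<noteq> 0" using u by auto
  show ?thesis
  proof
    show "((1 / x $ p) *s x) $ p = 1" using ps by simp
    have "(\<nu> *s y) $ p = (u * y $ p) / of_real (cmod (x $ p))" by (simp add: \<nu>_def)
    then show "(\<nu> *s y) $ p \<in> \<real>" using u(2) by (metis Reals_divide Reals_of_real)
    have "\<nu> \<noteq> 0" using \<open>u \<noteq> 0\<close> ps by (simp add: \<nu>_def)
    then show "(\<nu> *s y) $ s \<noteq> (\<nu> *s y) $ p * ((1 / x $ p) *s x) $ s"
      using ps by (simp add: field_simps)
    show "cmod ((S *v ((1 / x $ p) *s x)) $ i) = cmod ((S *v (\<nu> *s y)) $ i)" for i
    proof -
      have "S *v (c *s v) = c *s (S *v v)" for c v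
        by (simp add: vec.scale)
      then show ?thesis using S[of i] u by (simp add: norm_mult norm_divide \<nu>_def)
    qed
  qed
qed

text \<open>
  Parameters for the ambiguous matrices. Conjugation is not a rational operation, so a complex number
  and its conjugate are treated as independent variables, told apart by the flag \<open>bool\<close>
  (\<open>True\<close> for the conjugate). A number and its conjugate replace two real parameters. The real
  number \<open>y $ p\<close> and a phase, whose conjugate is its inverse, take one variable each.
  For \<open>j = p\<close> the variable \<open>Row b i j\<close> does not stand for an entry of row \<open>i\<close> but for the
  combination \<open>\<tau>\<close> of \<open>solve_for_two_entries\<close>.
\<close>
datatype ('m, 'n) param = X bool 'n | Y bool 'n | Phase 'm | Row bool 'm 'n

definition free_params :: "'n \<Rightarrow> 'n \<Rightarrow> ('m::finite, 'n::finite) param set" where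
  "free_params p s =
     (\<lambda>(b, j). X b j) ` (UNIV \<times> (- {p})) \<union> (\<lambda>(b, j). Y b j) ` (UNIV \<times> (- {p})) \<union> {Y False p}
     \<union> range Phase \<union> (\<lambda>(b, i, j). Row b i j) ` (UNIV \<times> UNIV \<times> (- {s}))"

lemma finite_free_params: "finite (free_params p s)"
  by (simp add: free_params_def)

text \<open>
  With \<open>N\<close> columns and \<open>M\<close> rows there are \<open>4 * N - 3\<close> parameters for \<open>x\<close> and \<open>y\<close> and
  \<open>2 * N - 1\<close> for each row, against \<open>2 * N\<close> real coordinates for each row: the parameters are too
  few as soon as \<open>M > 4 * N - 3\<close>. This is where the bound on \<open>M\<close> comes from.
\<close>
lemma card_free_params:
  assumes "CARD('m) \<ge> 4 * CARD('n) - 2"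
  shows "card (free_params p s :: ('m::finite, 'n::finite) param set) < CARD(bool \<times> 'm \<times> 'n)"
proof -
  define N where "N = CARD('n) - 1"
  have N: "CARD('n) = Suc N" by (simp add: N_def)
  have c: "card (- {a :: 'n}) = N" for a by (simp add: Compl_eq_Diff_UNIV N_def)
  have "card (free_params p s :: ('m, 'n) param set)
     \<le> card ((UNIV :: bool set) \<times> (- {p})) + card ((UNIV :: bool set) \<times> (- {p})) + 1
       + CARD('m) + card ((UNIV :: bool set) \<times> (UNIV :: 'm set) \<times> (- {s}))"
    unfolding free_params_def
    by (intro order_trans[OF card_Un_le] add_mono card_image_le) auto
  also have "\<dots> = 4 * N + 1 + CARD('m) + 2 * (CARD('m) * N)"
    by (simp add: card_cartesian_product c)
  also have "\<dots> < 2 * (CARD('m) * CARD('n))" using assms by (simp add: N)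
  finally show ?thesis by simp
qed

definition x_par :: "'n \<Rightarrow> (('m, 'n) param \<Rightarrow> complex) \<Rightarrow> bool \<Rightarrow> 'n \<Rightarrow> complex" where
  "x_par p z b j = (if j = p then 1 else z (X b j))"

definition y_par :: "'n \<Rightarrow> (('m, 'n) param \<Rightarrow> complex) \<Rightarrow> bool \<Rightarrow> 'n \<Rightarrow> complex" where
  "y_par p z b j = (if j = p then z (Y False p) else z (Y b j))"

text \<open>
  The vector \<open>y - w x\<close> to which a row is orthogonal, and its conjugate \<open>cnj y - cnj w * cnj x\<close>
  multiplied by \<open>w\<close>, where \<open>cnj w = 1 / w\<close> turns it into a polynomial.
\<close>
definition normal_par :: "'n \<Rightarrow> (('m, 'n) param \<Rightarrow> complex) \<Rightarrow> bool \<Rightarrow> 'm \<Rightarrow> 'n \<Rightarrow> complex" where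
  "normal_par p z b i j = (if b then z (Phase i) * y_par p z b j - x_par p z b j
                           else y_par p z b j - z (Phase i) * x_par p z b j)"

definition rest_par :: "'n::finite \<Rightarrow> 'n \<Rightarrow> (('m, 'n) param \<Rightarrow> complex) \<Rightarrow> bool \<Rightarrow> 'm \<Rightarrow> complex" where
  "rest_par p s z b i = (\<Sum>j\<in>- {p, s}. z (Row b i j) * normal_par p z b i j)"

text \<open>
  Numerators and denominators of the entries of a row and of their conjugates; the formulas for the
  columns \<open>p\<close> and \<open>s\<close> are those of \<open>solve_for_two_entries\<close> below.
\<close>
definition den_par :: "'n \<Rightarrow> 'n \<Rightarrow> (('m, 'n) param \<Rightarrow> complex) \<Rightarrow> bool \<Rightarrow> 'm \<Rightarrow> complex" where
  "den_par p s z b i =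
     (if b then z (Phase i) else 1) * (y_par p z b s - y_par p z b p * x_par p z b s)"

definition num_par ::
    "'n::finite \<Rightarrow> 'n \<Rightarrow> (('m, 'n) param \<Rightarrow> complex) \<Rightarrow> bool \<Rightarrow> 'm \<Rightarrow> 'n \<Rightarrow> complex" where
  "num_par p s z b i j =
     (if j = p then rest_par p s z b i * x_par p z b s + z (Row b i p) * normal_par p z b i s
      else if j = s then - rest_par p s z b i - z (Row b i p) * normal_par p z b i p
      else z (Row b i j) * den_par p s z b i)"

lemma poly_on_x_par: "poly_on (free_params p s) (\<lambda>z. x_par p z b j)"
  by (cases "j = p") (auto simp: x_par_def free_params_def intro!: poly_on_var)

lemma poly_on_y_par: "poly_on (free_params p s) (\<lambda>z. y_par p z b j)"
  by (cases "j = p") (auto simp: y_par_def free_params_def intro!: poly_on_var)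

lemma poly_on_phase: "poly_on (free_params p s) (\<lambda>z. z (Phase i))"
  by (auto simp: free_params_def intro!: poly_on_var)

lemma poly_on_row: "j \<noteq> s \<Longrightarrow> poly_on (free_params p s) (\<lambda>z. z (Row b i j))"
proof -
  assume "j \<noteq> s"
  then have "Row b i j \<in> (\<lambda>(b, i, j). Row b i j) ` (UNIV \<times> UNIV \<times> (- {s}))"
    by (intro image_eqI[of _ _ "(b, i, j)"]) auto
  then show ?thesis unfolding free_params_def
    by (intro poly_on_var) auto
qed

lemma poly_on_normal_par: "poly_on (free_params p s) (\<lambda>z. normal_par p z b i j)"
  by (cases b) (auto simp: normal_par_def
    intro!: poly_on_diff poly_on_mult poly_on_x_par poly_on_y_par poly_on_phase)

lemma poly_on_den_par: "poly_on (free_params p s) (\<lambda>z. den_par p s z b i)"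
  by (cases b) (auto simp: den_par_def
    intro!: poly_on_diff poly_on_mult poly_on_x_par poly_on_y_par poly_on_phase)

lemma poly_on_num_par:
  assumes "p \<noteq> s" shows "poly_on (free_params p s) (\<lambda>z. num_par p s z b i j)"
proof -
  have "poly_on (free_params p s) (\<lambda>z. rest_par p s z b i)"
    unfolding rest_par_def
    by (intro poly_on_sum poly_on_mult poly_on_row poly_on_normal_par) auto
  then show ?thesis using assms unfolding num_par_def
    by (cases "j = p"; cases "j = s")
      (auto intro!: poly_on_add poly_on_diff poly_on_minus poly_on_mult poly_on_row
         poly_on_normal_par poly_on_den_par poly_on_x_par)
qed

text \<open>
  A vector \<open>v\<close> with \<open>\<Sum>j. v j * n j = 0\<close> is recovered rationally from its entries outside
  \<open>{p, s}\<close> and from \<open>\<tau>\<close>. The linear system for \<open>v p\<close> and \<open>v s\<close> has determinant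
  \<open>n s - x s * n p = \<alpha> * (y s - y p * x s)\<close>, in which \<open>\<beta>\<close> cancels. So one pair \<open>p\<close>, \<open>s\<close>
  works for all the rows at once, whatever their phases are, and no further case distinction arises.
\<close>
lemma solve_for_two_entries:
  fixes v x y :: "'n::finite \<Rightarrow> complex"
  assumes "p \<noteq> s" "x p = 1" and n: "\<And>j. n j = \<alpha> * y j - \<beta> * x j" and "(\<Sum>j\<in>UNIV. v j * n j) = 0"
    and r: "r = (\<Sum>j\<in>- {p, s}. v j * n j)" and \<tau>: "\<tau> = v p + x s * v s"
  shows "\<alpha> * (y s - y p * x s) * v p = r * x s + \<tau> * n s"
    and "\<alpha> * (y s - y p * x s) * v s = - r - \<tau> * n p"
proof -
  have "(\<Sum>j\<in>UNIV. v j * n j) = (\<Sum>j\<in>- {p, s}. v j * n j) + (\<Sum>j\<in>{p, s}. v j * n j)"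
    using sum.subset_diff[of "{p, s}" UNIV "\<lambda>j. v j * n j"] by (simp add: Compl_eq_Diff_UNIV)
  then have "0 = r + (v p * n p + v s * n s)" using assms(4) \<open>p \<noteq> s\<close> by (simp add: r)
  then have r': "r = - v p * n p - v s * n s" by algebra
  show "\<alpha> * (y s - y p * x s) * v p = r * x s + \<tau> * n s"
    and "\<alpha> * (y s - y p * x s) * v s = - r - \<tau> * n p"
    unfolding r' \<tau> n \<open>x p = 1\<close> by (simp_all add: algebra_simps)
qed

definition conj_if :: "bool \<Rightarrow> complex \<Rightarrow> complex" where
  "conj_if b c = (if b then cnj c else c)"

text \<open>
  If \<open>(S *v x) $ i\<close> and \<open>(S *v y) $ i\<close> have the same modulus, they differ by a phase \<open>w i\<close>, so
  row \<open>i\<close> is orthogonal to \<open>y - w i *s x\<close>; then two of its entries can be solved for.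
\<close>
lemma ambiguous_parametrization:
  fixes S :: "complex^'n^'m"
  assumes "ambiguous S"
  obtains p s z where "p \<noteq> s" "\<And>b i. den_par p s z b i \<noteq> 0"
    "\<And>b i j. den_par p s z b i * conj_if b (S $ i $ j) = num_par p s z b i j"
proof -
  from assms obtain x y p s where x: "x $ p = 1" and y: "y $ p \<in> \<real>"
    and \<delta>: "y $ s \<noteq> y $ p * x $ s"
    and S: "\<And>i. cmod ((S *v x) $ i) = cmod ((S *v y) $ i)"
    by (rule ambiguous_normal_form) blast
  have "p \<noteq> s" using x \<delta> by auto
  have "\<exists>w. cmod w = 1 \<and> (S *v y) $ i = w * (S *v x) $ i" for i
  proof (cases "(S *v x) $ i = 0")
    case True
    then show ?thesis using S[of i] by (intro exI[of _ 1]) simp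
  next
    case False
    then have "cmod ((S *v y) $ i / (S *v x) $ i) = 1"
      by (simp add: norm_divide flip: S)
    then show ?thesis using False by (metis nonzero_divide_eq_eq)
  qed
  then obtain w where w: "\<And>i. cmod (w i) = 1" "\<And>i. (S *v y) $ i = w i * (S *v x) $ i"
    by metis
  have w_cnj: "w i * cnj (w i) = 1" for i
    using w(1)[of i] by (simp add: complex_norm_square[symmetric])
  have "w i \<noteq> 0" for i using w(1)[of i] by auto
  \<comment> \<open>For \<open>j = p\<close> the row variable carries \<open>\<tau>\<close>.\<close>
  define z where "z k = (case k of X b j \<Rightarrow> conj_if b (x $ j) | Y b j \<Rightarrow> conj_if b (y $ j)
    | Phase i \<Rightarrow> w i
    | Row b i j \<Rightarrow> conj_if b (if j = p then S $ i $ p + x $ s * S $ i $ s else S $ i $ j))" for k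
  have xp: "x_par p z b j = conj_if b (x $ j)" for b j
    by (simp add: x_par_def z_def x conj_if_def)
  have yp: "y_par p z b j = conj_if b (y $ j)" for b j
    using y by (simp add: y_par_def z_def conj_if_def Reals_cnj_iff)
  \<comment> \<open>The conjugate of \<open>y - w x\<close> is multiplied by \<open>w\<close>, which swaps the roles of \<open>1\<close> and \<open>w\<close>.\<close>
  define \<alpha> where "\<alpha> b i = (if b then w i else 1)" for b i
  define \<beta> where "\<beta> b i = (if b then 1 else w i)" for b i
  have np: "normal_par p z b i j = \<alpha> b i * conj_if b (y $ j) - \<beta> b i * conj_if b (x $ j)" for b i j
    by (simp add: normal_par_def xp yp \<alpha>_def \<beta>_def z_def)
  have dp: "den_par p s z b i
      = \<alpha> b i * (conj_if b (y $ s) - conj_if b (y $ p) * conj_if b (x $ s))" for b i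
    by (simp add: den_par_def xp yp \<alpha>_def z_def)
  have orth: "(\<Sum>j\<in>UNIV. conj_if b (S $ i $ j) * normal_par p z b i j) = 0" for b i
  proof -
    have F: "(\<Sum>j\<in>UNIV. S $ i $ j * (y $ j - w i * x $ j)) = 0"
      using w(2)[of i]
      by (simp add: matrix_vector_mult_def right_diff_distrib sum_subtractf sum_distrib_left mult_ac)
    have "(\<Sum>j\<in>UNIV. cnj (S $ i $ j) * (w i * cnj (y $ j) - cnj (x $ j)))
        = w i * cnj (\<Sum>j\<in>UNIV. S $ i $ j * (y $ j - w i * x $ j))"
      unfolding sum_distrib_left cnj_sum
    proof (rule sum.cong[OF refl])
      fix j
      show "cnj (S $ i $ j) * (w i * cnj (y $ j) - cnj (x $ j))
          = w i * cnj (S $ i $ j * (y $ j - w i * x $ j))"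
        using w_cnj[of i] by (simp, algebra)
    qed
    then show ?thesis using F
      by (cases b) (simp_all add: np \<alpha>_def \<beta>_def conj_if_def)
  qed
  have rp: "rest_par p s z b i = (\<Sum>j\<in>- {p, s}. conj_if b (S $ i $ j) * normal_par p z b i j)" for b i
    unfolding rest_par_def by (rule sum.cong) (auto simp: z_def)
  have row: "z (Row b i p) = conj_if b (S $ i $ p) + conj_if b (x $ s) * conj_if b (S $ i $ s)" for b i
    by (simp add: z_def conj_if_def)
  have xp1: "conj_if b (x $ p) = 1" for b by (simp add: x conj_if_def)
  have solve: "den_par p s z b i * conj_if b (S $ i $ p)
      = rest_par p s z b i * conj_if b (x $ s) + z (Row b i p) * normal_par p z b i s"
    "den_par p s z b i * conj_if b (S $ i $ s)
      = - rest_par p s z b i - z (Row b i p) * normal_par p z b i p" for b i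
    unfolding dp
    by (rule solve_for_two_entries[where x = "\<lambda>j. conj_if b (x $ j)" and y = "\<lambda>j. conj_if b (y $ j)"
          and v = "\<lambda>j. conj_if b (S $ i $ j)", OF \<open>p \<noteq> s\<close> xp1 np orth rp row])+
  show ?thesis
  proof
    show "p \<noteq> s" by fact
    show "den_par p s z b i \<noteq> 0" for b i
    proof -
      have "conj_if b (y $ s) - conj_if b (y $ p) * conj_if b (x $ s)
          = conj_if b (y $ s - y $ p * x $ s)" by (simp add: conj_if_def)
      moreover have "conj_if b (y $ s - y $ p * x $ s) \<noteq> 0"
        using \<delta> by (cases b) (simp_all add: conj_if_def del: complex_cnj_mult complex_cnj_diff)
      ultimately show ?thesis using \<open>w i \<noteq> 0\<close> by (simp only: dp) (simp add: \<alpha>_def)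
    qed
    show "den_par p s z b i * conj_if b (S $ i $ j) = num_par p s z b i j" for b i j
    proof -
      consider "j = p" | "j = s" | "j \<noteq> p" "j \<noteq> s" by blast
      then show ?thesis
      proof cases
        case 1
        then show ?thesis using solve(1)[of b i] by (simp add: num_par_def xp)
      next
        case 2
        then show ?thesis using solve(2)[of b i] \<open>p \<noteq> s\<close>
          by (simp add: num_par_def)
      next
        case 3
        then show ?thesis by (simp add: num_par_def z_def)
      qed
    qed
  qed
qed

definition real_coord :: "bool \<times> 'm \<times> 'n \<Rightarrow> complex^'n^'m \<Rightarrow> real" where
  "real_coord k S = (case k of (im, i, j) \<Rightarrow> if im then Im (S $ i $ j) else Re (S $ i $ j))"

lemma real_polynomial_function_real_coord:
  fixes k :: "bool \<times> 'm::finite \<times> 'n::finite"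
  shows "real_polynomial_function (real_coord k)"
proof -
  obtain im i j where k: "k = (im, i, j)" by (cases k) auto
  have "bounded_linear (\<lambda>S :: complex^'n^'m. S $ i $ j)"
    by (rule bounded_linear_compose[OF bounded_linear_vec_nth bounded_linear_vec_nth])
  then have "bounded_linear (\<lambda>S :: complex^'n^'m. Re (S $ i $ j))"
    "bounded_linear (\<lambda>S :: complex^'n^'m. Im (S $ i $ j))"
    by (auto intro: bounded_linear_compose[OF bounded_linear_Re] bounded_linear_compose[OF bounded_linear_Im])
  then show ?thesis unfolding real_coord_def k by (cases im) auto
qed

text \<open>
  The images of the parametrizations for all \<open>p \<noteq> s\<close> together contain the ambiguous matrices, so the
  dimension count applies to the real coordinates. The coefficients it produces are complex, but the
  coordinates are real, so the real and the imaginary parts of the coefficients also give polynomials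
  vanishing on the ambiguous matrices, and one of these two is nonzero.
\<close>
lemma polynomial_vanishing_on_ambiguous_matrices:
  assumes "CARD('m::finite) \<ge> 4 * CARD('n::finite) - 2"
  obtains q :: "complex^'n^'m \<Rightarrow> real" and S where "real_polynomial_function q" "q S \<noteq> 0"
    "\<And>S. ambiguous S \<Longrightarrow> q S = 0"
proof -
  define J :: "('n \<times> 'n) set" where "J = {(p, s). p \<noteq> s}"
  \<comment> \<open>\<open>f / g\<close> is \<open>(S + cnj S) / 2\<close> or \<open>(S - cnj S) / (2 * \<i>)\<close>, over a common denominator.\<close>
  define f :: "'n \<times> 'n \<Rightarrow> bool \<times> 'm \<times> 'n \<Rightarrow> (('m, 'n) param \<Rightarrow> complex) \<Rightarrow> complex"
    where "f = (\<lambda>(p, s) (im, i, j) z.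
      if im then num_par p s z False i j * den_par p s z True i - num_par p s z True i j * den_par p s z False i
      else num_par p s z False i j * den_par p s z True i + num_par p s z True i j * den_par p s z False i)"
  define g :: "'n \<times> 'n \<Rightarrow> bool \<times> 'm \<times> 'n \<Rightarrow> (('m, 'n) param \<Rightarrow> complex) \<Rightarrow> complex"
    where "g = (\<lambda>(p, s) (im, i, j) z.
      (if im then 2 * \<i> else 2) * (den_par p s z False i * den_par p s z True i))"
  have "\<exists>D c. (\<exists>e\<in>UNIV \<rightarrow>\<^sub>E {..<D}. c e \<noteq> 0) \<and>
    (\<forall>j\<in>J. \<forall>z \<phi>. (\<forall>i. g j i z \<noteq> 0 \<and> g j i z * \<phi> i = f j i z) \<longrightarrow>
       (\<Sum>e\<in>UNIV \<rightarrow>\<^sub>E {..<D}. c e * (\<Prod>i\<in>UNIV. \<phi> i ^ e i)) = 0)"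
  proof (rule polynomial_vanishing_on_rational_images[where K = "\<lambda>(p, s). free_params p s"])
    fix j :: "'n \<times> 'n" and k :: "bool \<times> 'm \<times> 'n"
    assume "j \<in> J"
    then obtain p s where ps: "j = (p, s)" "p \<noteq> s" by (auto simp: J_def)
    obtain im i l where k: "k = (im, i, l)" by (cases k) auto
    show "poly_on (case j of (p, s) \<Rightarrow> free_params p s) (f j k)"
      using ps by (cases im) (auto simp: f_def k
        intro!: poly_on_add poly_on_diff poly_on_mult poly_on_num_par poly_on_den_par)
    show "poly_on (case j of (p, s) \<Rightarrow> free_params p s) (g j k)"
      using ps by (cases im) (auto simp: g_def k intro!: poly_on_mult poly_on_den_par)
  qed (auto simp: finite_free_params card_free_params[OF assms, simplified])
  then obtain D c where nz: "\<exists>e\<in>UNIV \<rightarrow>\<^sub>E {..<D}. c e \<noteq> 0"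
    and vanish: "\<forall>j\<in>J. \<forall>z \<phi>. (\<forall>i. g j i z \<noteq> 0 \<and> g j i z * \<phi> i = f j i z) \<longrightarrow>
       (\<Sum>e\<in>UNIV \<rightarrow>\<^sub>E {..<D}. c e * (\<Prod>i\<in>UNIV. \<phi> i ^ e i)) = 0"
    by (elim exE conjE)
  from nz obtain e0 where e0: "e0 \<in> UNIV \<rightarrow>\<^sub>E {..<D}" "c e0 \<noteq> 0" by (elim bexE)
  have c: "(\<Sum>e\<in>UNIV \<rightarrow>\<^sub>E {..<D}. c e * (\<Prod>i\<in>UNIV. \<phi> i ^ e i)) = 0"
    if "p \<noteq> s" "\<And>i. g (p, s) i z \<noteq> 0 \<and> g (p, s) i z * \<phi> i = f (p, s) i z" for p s z \<phi>
    using vanish[THEN bspec, of "(p, s)", THEN spec, of z, THEN spec, of \<phi>] that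
    by (simp add: J_def)
  define E :: "(bool \<times> 'm \<times> 'n \<Rightarrow> nat) set" where "E = UNIV \<rightarrow>\<^sub>E {..<D}"
  have "finite E" unfolding E_def by (intro finite_PiE) auto
  define d where "d e = (if Re (c e0) \<noteq> 0 then Re (c e) else Im (c e))" for e
  have "d e0 \<noteq> 0" using e0 by (auto simp: d_def complex_eq_iff)
  define q :: "complex^'n^'m \<Rightarrow> real" where "q S = (\<Sum>e\<in>E. d e * (\<Prod>k\<in>UNIV. real_coord k S ^ e k))" for S
  have "real_polynomial_function q" unfolding q_def
    by (intro real_polynomial_function_sum real_polynomial_function.intros(2,4)
      real_polynomial_function_prod real_polynomial_function_power real_polynomial_function_real_coord
      \<open>finite E\<close>) auto
  moreover obtain S where "q S \<noteq> 0"
  proof -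
    have "inj_on (\<lambda>e. restrict e UNIV) E" by (auto intro: inj_onI simp: restrict_UNIV)
    from nonzero_polynomial_has_nonzero_value[OF finite \<open>finite E\<close> this, of e0 d]
    obtain r where r: "(\<Sum>e\<in>E. d e * (\<Prod>k\<in>UNIV. r k ^ e k)) \<noteq> 0"
      using e0 \<open>d e0 \<noteq> 0\<close> by (auto simp: E_def)
    define S :: "complex^'n^'m" where "S = (\<chi> i j. Complex (r (False, i, j)) (r (True, i, j)))"
    have "real_coord k S = r k" for k by (cases k) (auto simp: real_coord_def S_def)
    then show ?thesis using r that[of S] by (simp add: q_def)
  qed
  moreover have "q S = 0" if "ambiguous S" for S
  proof -
    from that obtain p s z where "p \<noteq> s" and den: "\<And>b i. den_par p s z b i \<noteq> 0"
      and num: "\<And>b i j. den_par p s z b i * conj_if b (S $ i $ j) = num_par p s z b i j"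
      by (rule ambiguous_parametrization) blast
    have "(\<Sum>e\<in>E. c e * (\<Prod>k\<in>UNIV. complex_of_real (real_coord k S) ^ e k)) = 0"
      unfolding E_def
    proof (rule c[OF \<open>p \<noteq> s\<close>])
      fix k :: "bool \<times> 'm \<times> 'n"
      obtain im i j where k: "k = (im, i, j)" by (cases k) auto
      have "2 * complex_of_real (Re (S $ i $ j)) = S $ i $ j + cnj (S $ i $ j)"
        "2 * \<i> * complex_of_real (Im (S $ i $ j)) = S $ i $ j - cnj (S $ i $ j)"
        by (auto simp: complex_eq_iff)
      moreover have "den_par p s z False i * S $ i $ j = num_par p s z False i j"
        "den_par p s z True i * cnj (S $ i $ j) = num_par p s z True i j"
        using num[of False i j] num[of True i j] by (auto simp: conj_if_def)
      ultimately have
        "2 * (den_par p s z False i * den_par p s z True i) * complex_of_real (Re (S $ i $ j))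
         = num_par p s z False i j * den_par p s z True i + num_par p s z True i j * den_par p s z False i"
        "2 * \<i> * (den_par p s z False i * den_par p s z True i) * complex_of_real (Im (S $ i $ j))
         = num_par p s z False i j * den_par p s z True i - num_par p s z True i j * den_par p s z False i"
        by algebra+
      then show "g (p, s) k z \<noteq> 0 \<and>
          g (p, s) k z * complex_of_real (real_coord k S) = f (p, s) k z"
        using den by (simp add: g_def f_def k real_coord_def)
    qed
    then have "(\<Sum>e\<in>E. c e * complex_of_real (\<Prod>k\<in>UNIV. real_coord k S ^ e k)) = 0" by simp
    then have "Re (\<Sum>e\<in>E. c e * complex_of_real (\<Prod>k\<in>UNIV. real_coord k S ^ e k)) = 0"
      "Im (\<Sum>e\<in>E. c e * complex_of_real (\<Prod>k\<in>UNIV. real_coord k S ^ e k)) = 0" by (simp_all del: Re_sum Im_sum)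
    then show ?thesis unfolding q_def d_def
      by (cases "Re (c e0) = 0") (simp_all del: of_real_prod of_real_power)
  qed
  ultimately show ?thesis using that by blast
qed

text \<open>
  For at least two columns, a matrix that is not injective is ambiguous: if \<open>S *v x = 0\<close>, then
  \<open>x + y\<close> and \<open>y\<close> have the same image for every \<open>y\<close>. A single column is never ambiguous, and
  any coordinate serves as the polynomial.
\<close>
lemma generic_polynomial:
  assumes "CARD('m::finite) \<ge> 4 * CARD('n::finite) - 2"
  obtains q :: "complex^'n^'m \<Rightarrow> real" and S where "real_polynomial_function q" "q S \<noteq> 0"
    "\<And>S. q S \<noteq> 0 \<Longrightarrow> inj ((*v) S) \<and> \<not> ambiguous S"
proof (cases "CARD('n) = 1")
  case True
  then obtain a :: 'n where a: "UNIV = {a}" by (auto simp: card_1_singleton_iff)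
  then have one: "x = a" for x by (metis UNIV_I singletonD)
  define i :: 'm where "i = undefined"
  define q :: "complex^'n^'m \<Rightarrow> real" where "q = real_coord (False, i, a)"
  define S :: "complex^'n^'m" where "S = (\<chi> i j. 1)"
  show ?thesis
  proof
    show "real_polynomial_function q"
      unfolding q_def by (rule real_polynomial_function_real_coord)
    show "q S \<noteq> 0" by (simp add: q_def S_def real_coord_def)
    fix S' assume "q S' \<noteq> 0"
    then have S': "S' $ i $ a \<noteq> 0" by (auto simp: q_def real_coord_def)
    have "x = 0" if "S' *v x = 0" for x
    proof -
      have "(S' *v x) $ i = S' $ i $ a * x $ a" by (simp add: matrix_vector_mult_def a)
      then have "x $ a = 0" using that S' by simp
      then show "x = 0" unfolding vec_eq_iff by (metis one zero_index)
    qed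
    then have "inj ((*v) S')" by (simp add: vec.inj_iff_eq_0)
    moreover have "\<not> ambiguous S'"
      unfolding ambiguous_def by (metis one)
    ultimately show "inj ((*v) S') \<and> \<not> ambiguous S'" ..
  qed
next
  case False
  obtain q :: "complex^'n^'m \<Rightarrow> real" and S where q: "real_polynomial_function q" "q S \<noteq> 0"
    "\<And>S. ambiguous S \<Longrightarrow> q S = 0"
    using polynomial_vanishing_on_ambiguous_matrices[OF assms] by blast
  have "ambiguous S" if "\<not> inj ((*v) S)" for S :: "complex^'n^'m"
  proof -
    from that obtain x where x: "S *v x = 0" "x \<noteq> 0" by (auto simp: vec.inj_iff_eq_0)
    then obtain p where p: "x $ p \<noteq> 0" by (auto simp: vec_eq_iff)
    have "\<exists>s. s \<noteq> p"
    proof (rule ccontr)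
      assume "\<not> ?thesis"
      then have "(UNIV :: 'n set) = {p}" by auto
      then have "CARD('n) = card {p}" by (rule arg_cong)
      then show "False" using False by simp
    qed
    then obtain s where s: "s \<noteq> p" ..
    define y :: "complex^'n" where "y = axis s 1"
    have "(x + y) $ p * y $ s \<noteq> (x + y) $ s * y $ p" using p s by (simp add: y_def axis_def)
    moreover have "S *v (x + y) = S *v y" using x by (simp add: matrix_vector_right_distrib)
    ultimately show ?thesis unfolding ambiguous_def by metis
  qed
  with q that show ?thesis by blast
qed

section \<open>Zariski open sets of ranges\<close>

lemma bounded_linear_matrix_mult_right:
  "bounded_linear (\<lambda>S :: complex^'n^'m. S ** (T :: complex^'k^'n))"
  unfolding linear_conv_bounded_linear[symmetric]
  by (intro linearI) (auto simp: vec_eq_iff matrix_matrix_mult_def sum.distrib distrib_right scaleR_sum_right)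

lemma matrix_range_in_grassmannian:
  assumes "inj ((*v) (S :: complex^'n^'m))"
  shows "matrix_range S \<in> grassmannian TYPE('n::finite)"
proof -
  have "vec.subspace (matrix_range S)" unfolding matrix_range_def
    by (intro vec.linear_subspace_image matrix_vector_mul_linear_gen vec.subspace_UNIV)
  moreover have "vec.dim (matrix_range S) = CARD('n)" unfolding matrix_range_def
    using vec.dim_image_eq[OF matrix_vector_mul_linear_gen, of S UNIV] assms
    by (simp add: card_cart_basis)
  ultimately show ?thesis by (simp add: grassmannian_def)
qed

lemma factor_through_range:
  fixes S :: "complex^'n^'m" and S' :: "complex^'k^'m"
  assumes "matrix_range S' \<subseteq> matrix_range S"
  obtains T where "S' = S ** T"
proof -
  have "\<exists>v. S' *v axis j 1 = S *v v" for j
    using assms by (auto simp: matrix_range_def)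
  then obtain v where v: "\<And>j. S' *v axis j 1 = S *v v j" by metis
  have "S' $ i $ j = (S ** (\<chi> i j. v j $ i)) $ i $ j" for i j
  proof -
    have "S' $ i $ j = (S' *v axis j 1) $ i"
      by (simp add: matrix_vector_mult_def axis_def if_distrib cong: if_cong)
    also have "\<dots> = (S *v v j) $ i" by (simp only: v)
    finally show ?thesis by (simp add: matrix_vector_mult_def matrix_matrix_mult_def)
  qed
  then show ?thesis using that by (metis vec_eq_iff)
qed

lemma matrix_range_mult_inj:
  fixes S :: "complex^'n^'m" and T :: "complex^'n^'n"
  assumes "inj ((*v) (S ** T))"
  shows "matrix_range (S ** T) = matrix_range S"
proof -
  have "inj ((*v) T)" using assms
    by (metis (no_types, lifting) injD injI matrix_vector_mul_assoc)
  then have "surj ((*v) T)"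
    by (intro vec.linear_inj_imp_surj matrix_vector_mul_linear_gen)
  then have "range (\<lambda>v. S *v (T *v v)) = range ((*v) S)"
    by (metis image_image)
  then show ?thesis by (simp add: matrix_range_def matrix_vector_mul_assoc)
qed

text \<open>
  The set of ranges of matrices with \<open>q \<noteq> 0\<close> is open although \<open>q\<close> need not be invariant under a
  change of basis of the range: the matrices with the range of \<open>S\<close> on which \<open>q\<close> is nonzero are of
  the form \<open>S ** T\<close>, so the polynomials \<open>\<lambda>S. q (S ** T)\<close>, for all \<open>T\<close>, describe the set in every
  chart. A singular \<open>T\<close> does no harm, since \<open>q (S ** T) \<noteq> 0\<close> makes \<open>S ** T\<close> injective.
\<close>
lemma zariski_open_nonvanishing:
  fixes q :: "complex^'n::finite^'m::finite \<Rightarrow> real"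
  assumes q: "real_polynomial_function q" and inj: "\<And>S. q S \<noteq> 0 \<Longrightarrow> inj ((*v) S)"
  shows "zariski_open TYPE('n) {matrix_range S | S. q S \<noteq> 0}"
  unfolding zariski_open_def
proof (intro conjI allI impI)
  show "{matrix_range S | S. q S \<noteq> 0} \<subseteq> grassmannian TYPE('n)"
    using inj matrix_range_in_grassmannian by blast
  fix \<sigma> :: "'n \<Rightarrow> 'm"
  let ?Q = "range (\<lambda>T S. q (S ** T))"
  have "real_polynomial_function (\<lambda>S. q (S ** T))" for T :: "complex^'n^'n"
    using real_polynomial_function_compose[OF
        polynomial_function_bounded_linear[OF bounded_linear_matrix_mult_right] q]
    by (simp add: o_def)
  moreover have "matrix_range S \<in> {matrix_range S | S. q S \<noteq> 0} \<longleftrightarrow> (\<exists>f\<in>?Q. f S \<noteq> 0)"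
    for S :: "complex^'n^'m"
  proof
    assume "matrix_range S \<in> {matrix_range S | S. q S \<noteq> 0}"
    then obtain S' where S': "matrix_range S' = matrix_range S" "q S' \<noteq> 0" by auto
    then obtain T where "S' = S ** T" by (metis factor_through_range order_refl)
    then show "\<exists>f\<in>?Q. f S \<noteq> 0" using S' by auto
  next
    assume "\<exists>f\<in>?Q. f S \<noteq> 0"
    then obtain T where T: "q (S ** T) \<noteq> 0" by auto
    then have "matrix_range (S ** T) = matrix_range S" by (intro matrix_range_mult_inj inj)
    then show "matrix_range S \<in> {matrix_range S | S. q S \<noteq> 0}" 
      using T by (intro CollectI exI[of _ "S ** T"]) simp
  qed
  ultimately show "\<exists>Q. (\<forall>q\<in>Q. real_polynomial_function q) \<and> (\<forall>S\<in>chart_domain \<sigma>.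
      matrix_range S \<in> {matrix_range S | S. q S \<noteq> 0} \<longleftrightarrow> (\<exists>q\<in>Q. q S \<noteq> 0))"
    by (intro exI[of _ ?Q]) auto
qed

section \<open>Phase and amplitude correction\<close>

lemma unit_multiple_in_solution_set:
  assumes "cmod u = 1" shows "u *s (S *v \<psi>) \<in> solution_set S \<psi>"
proof -
  obtain t where "0 \<le> t" "t < 2 * pi" "u = Complex (cos t) (sin t)"
    using complex_unimodular_polar[OF assms] .
  then show ?thesis unfolding solution_set_def by (auto simp: cis.ctr)
qed

lemma phase_retrieval:
  fixes S S' :: "complex^'n::finite^'m::finite"
  assumes "\<not> ambiguous S'" "matrix_range S' = matrix_range S"
    and nz: "\<And>i. (S *v \<psi>) $ i \<noteq> 0"
    and w: "w \<in> matrix_range S" "\<And>i. cmod (w $ i) = cmod ((S *v \<psi>) $ i)"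
  shows "w \<in> solution_set S \<psi>"
proof -
  have "S *v \<psi> \<in> matrix_range S'" "w \<in> matrix_range S'" using assms(2) w(1)
    by (auto simp: matrix_range_def)
  then obtain x y where x: "w = S' *v x" and y: "S *v \<psi> = S' *v y"
    by (auto simp: matrix_range_def)
  have dep: "x $ p * y $ s = x $ s * y $ p" for p s
    using assms(1) w(2) unfolding ambiguous_def x y by metis
  have "y \<noteq> 0" using nz[of undefined] y by auto
  then obtain p where p: "y $ p \<noteq> 0" by (auto simp: vec_eq_iff)
  define u where "u = x $ p / y $ p"
  have "x = u *s y" using p dep[of _ p] by (simp add: vec_eq_iff u_def field_simps)
  then have wu: "w = u *s (S *v \<psi>)" by (simp add: x y vec.scale)
  have "cmod u * cmod ((S *v \<psi>) $ i) = cmod ((S *v \<psi>) $ i)" for i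
    using w(2)[of i] by (simp add: wu norm_mult)
  then have "cmod u = 1" using nz[of undefined] by (metis mult_cancel_right1 norm_eq_zero)
  then show ?thesis by (simp add: wu unit_multiple_in_solution_set)
qed

text \<open>
  A vector in the kernel is orthogonal to all frame vectors, hence to their span, which contains the
  vector itself.
\<close>
lemma inj_frame_matrix:
  assumes "frame_matrix (S :: complex^'n^'m)" shows "inj ((*v) S)"
proof -
  from assms obtain f where f: "vec.span (range f) = UNIV" and S: "S = (\<chi> i j. cnj (f i $ j))"
    by (auto simp: frame_matrix_def frame_def)
  have "x = 0" if "S *v x = 0" for x
  proof -
    let ?H = "{v. (\<Sum>j\<in>UNIV. v $ j * cnj (x $ j)) = 0}"
    have "vec.subspace ?H"
      by (auto simp: vec.subspace_def distrib_right sum.distrib mult.assoc simp flip: sum_distrib_left)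
    moreover have "range f \<subseteq> ?H"
    proof clarify
      fix i
      have "cnj ((S *v x) $ i) = (\<Sum>j\<in>UNIV. f i $ j * cnj (x $ j))"
        by (simp add: S matrix_vector_mult_def)
      then show "(\<Sum>j\<in>UNIV. f i $ j * cnj (x $ j)) = 0" using that by simp
    qed
    ultimately have "x \<in> ?H" using vec.span_minimal f by blast
    then have "complex_of_real (\<Sum>j\<in>UNIV. (cmod (x $ j))\<^sup>2) = 0"
      by (simp add: complex_norm_square[symmetric] del: of_real_power)
    then show "x = 0"
      by (simp add: sum_nonneg_eq_0_iff vec_eq_iff del: of_real_sum of_real_power)
  qed
  then show ?thesis by (simp add: vec.inj_iff_eq_0)
qed

lemma ctranspose_adjoint:
  "(\<Sum>j\<in>UNIV. (ctranspose S *v z) $ j * cnj (x $ j)) = (\<Sum>i\<in>UNIV. z $ i * cnj ((S *v x) $ i))"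
proof -
  have "(\<Sum>j\<in>UNIV. (ctranspose S *v z) $ j * cnj (x $ j))
      = (\<Sum>j\<in>UNIV. \<Sum>i\<in>UNIV. z $ i * (cnj (S $ i $ j) * cnj (x $ j)))"
    by (simp add: ctranspose_def matrix_vector_mult_def sum_distrib_left sum_distrib_right mult_ac)
  also have "\<dots> = (\<Sum>i\<in>UNIV. z $ i * cnj ((S *v x) $ i))"
    by (subst sum.swap) (simp add: matrix_vector_mult_def sum_distrib_left)
  finally show ?thesis .
qed

lemma gram_matrix_inv:
  fixes S :: "complex^'n^'m"
  assumes "inj ((*v) S)"
  shows "matrix_inv (ctranspose S ** S) ** (ctranspose S ** S) = mat 1"
proof -
  have "x = 0" if "(ctranspose S ** S) *v x = 0" for x
  proof -
    have "(\<Sum>i\<in>UNIV. (S *v x) $ i * cnj ((S *v x) $ i)) = 0"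
      using that by (simp flip: ctranspose_adjoint add: matrix_vector_mul_assoc)
    then have "complex_of_real (\<Sum>i\<in>UNIV. (cmod ((S *v x) $ i))\<^sup>2) = 0"
      by (simp add: complex_norm_square[symmetric] del: of_real_power)
    then have "S *v x = 0"
      by (simp add: sum_nonneg_eq_0_iff vec_eq_iff del: of_real_sum of_real_power)
    then show "x = 0" using assms by (simp add: vec.inj_iff_eq_0)
  qed
  then have "invertible (ctranspose S ** S)"
    unfolding invertible_left_inverse matrix_left_invertible_ker by blast
  then show ?thesis
    unfolding invertible_def matrix_inv_def by (rule someI2_ex) auto
qed

lemma phase_corr_in_range: "phase_corr S z \<in> matrix_range S"
  by (simp add: phase_corr_def matrix_range_def flip: matrix_vector_mul_assoc)

lemma phase_corr_fixes_range:
  assumes "frame_matrix S" "z \<in> matrix_range S" shows "phase_corr S z = z"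
proof -
  from assms(2) obtain x where z: "z = S *v x" by (auto simp: matrix_range_def)
  have "S ** matrix_inv (ctranspose S ** S) ** ctranspose S ** S = S"
    using gram_matrix_inv[OF inj_frame_matrix[OF assms(1)]]
    by (metis matrix_mul_assoc matrix_mul_rid)
  then show ?thesis by (simp add: phase_corr_def z matrix_vector_mul_assoc)
qed

lemma bounded_linear_phase_corr: "bounded_linear (phase_corr (S :: complex^'n^'m))"
proof -
  have "bounded_linear (\<lambda>z. (A :: complex^'m^'m) *v z)" for A
    unfolding linear_conv_bounded_linear[symmetric]
    by (intro linearI)
      (auto simp: vec_eq_iff matrix_vector_mult_def sum.distrib distrib_left scaleR_sum_right)
  then show ?thesis unfolding phase_corr_def .
qed

lemma cmod_amp_corr: "a $ i \<ge> 0 \<Longrightarrow> cmod (amp_corr a z $ i) = a $ i"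
  by (simp add: amp_corr_def norm_mult norm_divide)

text \<open>
  The corrected entry is a point of the circle of radius \<open>a $ i\<close> nearest to the original entry:
  it lies on the same ray from the origin, and for the entry \<open>0\<close> all points of the circle are
  equally near.
\<close>
lemma norm_amp_corr_diff_le:
  assumes v: "\<And>i. cmod (v $ i) = a $ i"
  shows "norm (amp_corr a z - z) \<le> norm (v - z)"
  unfolding norm_vec_def
proof (rule L2_set_mono)
  fix i
  have a: "a $ i \<ge> 0" using v[of i] norm_ge_zero[of "v $ i"] by simp
  have "cmod ((amp_corr a z - z) $ i) = \<bar>a $ i - cmod (z $ i)\<bar>"
  proof (cases "z $ i = 0")
    case True
    then show ?thesis using a by (simp add: amp_corr_def)
  next
    case False
    then have "(amp_corr a z - z) $ i
        = complex_of_real (a $ i - cmod (z $ i)) * (z $ i / of_real (cmod (z $ i)))"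
      by (simp add: amp_corr_def field_simps)
    then show ?thesis using False by (simp only: norm_mult norm_divide norm_of_real) simp
  qed
  also have "\<dots> \<le> cmod ((v - z) $ i)"
    using norm_triangle_ineq3[of "v $ i" "z $ i"] by (simp add: v)
  finally show "cmod ((amp_corr a z - z) $ i) \<le> cmod ((v - z) $ i)" .
qed simp

text \<open>
  By compactness: the sequence is bounded, since amplitude correction has norm \<open>norm a\<close>, and every
  limit point lies in \<open>R\<close> and has moduli \<open>a\<close>.
\<close>
lemma small_amplitude_defect_imp_close:
  fixes \<eta> :: "nat \<Rightarrow> complex^'m"
  assumes "closed R" and \<eta>: "\<And>l. \<eta> l \<in> R" and a: "\<And>i. a $ i \<ge> 0"
    and A: "\<And>w. w \<in> R \<Longrightarrow> (\<And>i. cmod (w $ i) = a $ i) \<Longrightarrow> w \<in> A"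
    and lim: "(\<lambda>l. norm (amp_corr a (\<eta> l) - \<eta> l)) \<longlonglongrightarrow> 0"
  shows "(\<lambda>l. infdist (\<eta> l) A) \<longlonglongrightarrow> 0"
proof (rule tendstoI, rule ccontr)
  fix \<epsilon> :: real assume "\<epsilon> > 0" and "\<not> (\<forall>\<^sub>F l in sequentially. dist (infdist (\<eta> l) A) 0 < \<epsilon>)"
  then obtain r :: "nat \<Rightarrow> nat" where r: "strict_mono r" "\<And>n. \<not> dist (infdist (\<eta> (r n)) A) 0 < \<epsilon>"
    using not_eventually_sequentiallyD by blast
  define \<delta> where "\<delta> l = amp_corr a (\<eta> l) - \<eta> l" for l
  have \<delta>: "\<delta> \<longlonglongrightarrow> 0" using lim tendsto_norm_zero_iff unfolding \<delta>_def by blast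
  have "bounded (range \<eta>)"
  proof -
    have "Bseq \<delta>" using \<delta> by (intro convergent_imp_Bseq convergentI)
    then obtain B where B: "\<And>l. norm (\<delta> l) \<le> B" unfolding Bseq_def by blast
    have "norm (amp_corr a z) = norm a" for z
      unfolding norm_vec_def using a by (intro L2_set_cong) (auto simp: cmod_amp_corr)
    moreover have "norm (\<eta> l) \<le> norm (amp_corr a (\<eta> l)) + norm (\<delta> l)" for l
      unfolding \<delta>_def by (metis add_diff_cancel_left' diff_diff_eq2 norm_triangle_ineq4)
    ultimately have "norm (\<eta> l) \<le> norm a + B" for l using B[of l] by (metis add_left_mono order_trans)
    then show ?thesis unfolding bounded_iff by blast
  qed
  then have "bounded (range (\<eta> \<circ> r))" by (rule bounded_subset) auto
  then obtain w r' where r': "strict_mono r'" "(\<eta> \<circ> r \<circ> r') \<longlonglongrightarrow> w"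
    using bounded_imp_convergent_subsequence by blast
  have sub: "strict_mono (r \<circ> r')" using r(1) r'(1) by (rule strict_mono_o)
  have "w \<in> R" using \<open>closed R\<close> _ r'(2) by (rule closed_sequentially) (simp add: \<eta>)
  moreover have "cmod (w $ i) = a $ i" for i
  proof -
    have "(\<lambda>n. (\<eta> \<circ> r \<circ> r') n + (\<delta> \<circ> (r \<circ> r')) n) \<longlonglongrightarrow> w + 0"
      by (intro tendsto_add r'(2) LIMSEQ_subseq_LIMSEQ[OF \<delta> sub])
    then have "(\<lambda>n. cmod (((\<eta> \<circ> r \<circ> r') n + (\<delta> \<circ> (r \<circ> r')) n) $ i)) \<longlonglongrightarrow> cmod (w $ i)"
      by (intro tendsto_norm tendsto_vec_nth) simp
    moreover have "cmod (((\<eta> \<circ> r \<circ> r') n + (\<delta> \<circ> (r \<circ> r')) n) $ i) = a $ i" for n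
      using a by (simp add: \<delta>_def cmod_amp_corr del: vector_add_component vector_minus_component)
    ultimately show ?thesis by (simp add: LIMSEQ_const_iff)
  qed
  ultimately have "infdist w A = 0" using A by simp
  moreover have "(\<lambda>n. infdist ((\<eta> \<circ> r \<circ> r') n) A) \<longlonglongrightarrow> infdist w A"
    by (intro tendsto_infdist r'(2))
  ultimately have "\<forall>\<^sub>F n in sequentially. dist (infdist ((\<eta> \<circ> r \<circ> r') n) A) 0 < \<epsilon>"
    using \<open>\<epsilon> > 0\<close> tendstoD by metis
  then show False using r(2) by (auto simp: eventually_sequentially)
qed

section \<open>Convergence of alternating projections\<close>

text \<open>
  All iterates after the initial one lie in the range. From the first condition, the amplitude defect
  is at most the distance to any vector with moduli \<open>a\<close>, in particular to the solution set; from the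
  third, \<open>\<zeta>half l\<close> is such a vector at distance \<open>norm (phase_corr S (\<zeta>half l) - \<zeta>half l)\<close> from
  \<open>\<zeta> (Suc l)\<close>. The second implies the third because the phase correction is bounded, linear and the
  identity on the range. The step from the second condition to the first is the one that rests on
  phase retrieval.
\<close>
lemma alternating_projection_conditions:
  fixes S S' :: "complex^'n::finite^'m::finite" and \<zeta> \<zeta>half :: "nat \<Rightarrow> complex^'m"
  assumes frame: "frame_matrix S" and "\<not> ambiguous S'" "matrix_range S' = matrix_range S"
    and a: "a = cmod_vec (S *v \<psi>)" and nz: "\<And>i. a $ i \<noteq> 0"
    and half: "\<And>l. \<zeta>half l = amp_corr a (\<zeta> l)"
    and step: "\<And>l. \<zeta> (Suc l) = phase_corr S (\<zeta>half l)"
  defines "c1 \<equiv> ((\<lambda>l. infdist (\<zeta> l) (solution_set S \<psi>)) \<longlonglongrightarrow> 0)"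
    and "c2 \<equiv> ((\<lambda>l. norm (amp_corr a (\<zeta> l) - \<zeta> l)) \<longlonglongrightarrow> 0)"
    and "c3 \<equiv> ((\<lambda>l. norm (phase_corr S (\<zeta>half l) - \<zeta>half l)) \<longlonglongrightarrow> 0)"
    and "c4 \<equiv> ((\<lambda>l. norm (\<zeta> (Suc l) - \<zeta> l)) \<longlonglongrightarrow> 0)"
  shows "c1 \<longleftrightarrow> c2" "c2 \<longleftrightarrow> c3" "c1 \<longrightarrow> c4"
proof -
  have mod_a: "cmod ((S *v \<psi>) $ i) = a $ i" for i by (simp add: a cmod_vec_def)
  have nz': "(S *v \<psi>) $ i \<noteq> 0" for i using nz[of i] mod_a[of i] by auto
  have a_nonneg: "a $ i \<ge> 0" for i by (simp flip: mod_a)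
  have mod_sol: "cmod (v $ i) = a $ i" if "v \<in> solution_set S \<psi>" for v i
    using that by (auto simp: solution_set_def norm_mult mod_a)
  have sol_ne: "solution_set S \<psi> \<noteq> {}" using unit_multiple_in_solution_set[of 1 S \<psi>] by auto
  have in_range: "\<zeta> (Suc l) \<in> matrix_range S" for l by (simp add: step phase_corr_in_range)

  have "matrix_range S = {z. phase_corr S z = z}"
    using phase_corr_in_range[of S] phase_corr_fixes_range[OF frame] by (auto, metis)
  moreover have "closed {z. phase_corr S z = z}"
    by (intro closed_Collect_eq continuous_intros
        bounded_linear.continuous_on[OF bounded_linear_phase_corr])
  ultimately have closed: "closed (matrix_range S)" by simp

  have c1_c2: c2 if c1
    unfolding c2_def
  proof (rule tendsto_sandwich[OF _ _ tendsto_const \<open>c1\<close>[unfolded c1_def]])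
    have "norm (amp_corr a (\<zeta> l) - \<zeta> l) \<le> infdist (\<zeta> l) (solution_set S \<psi>)" for l
      unfolding infdist_notempty[OF sol_ne]
    proof (rule cINF_greatest[OF sol_ne])
      fix v assume "v \<in> solution_set S \<psi>"
      then show "norm (amp_corr a (\<zeta> l) - \<zeta> l) \<le> dist (\<zeta> l) v"
        using norm_amp_corr_diff_le[OF mod_sol] by (simp add: dist_norm norm_minus_commute)
    qed
    then show "\<forall>\<^sub>F l in sequentially. norm (amp_corr a (\<zeta> l) - \<zeta> l) \<le> infdist (\<zeta> l) (solution_set S \<psi>)"
      by simp
  qed simp

  have c2_c1: c1 if c2
  proof -
    have "(\<lambda>l. infdist (\<zeta> (Suc l)) (solution_set S \<psi>)) \<longlonglongrightarrow> 0"
    proof (rule small_amplitude_defect_imp_close[OF closed in_range a_nonneg])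
      fix w assume "w \<in> matrix_range S" "\<And>i. cmod (w $ i) = a $ i"
      then show "w \<in> solution_set S \<psi>"
        by (intro phase_retrieval[OF assms(2,3) nz']) (simp_all add: mod_a)
    next
      show "(\<lambda>l. norm (amp_corr a (\<zeta> (Suc l)) - \<zeta> (Suc l))) \<longlonglongrightarrow> 0"
        using that unfolding c2_def by (rule LIMSEQ_Suc)
    qed
    then show ?thesis unfolding c1_def by (rule LIMSEQ_imp_Suc)
  qed

  have c2_c3: c3 if c2
  proof -
    obtain K where K: "\<And>z. norm (phase_corr S z) \<le> norm z * K"
      using bounded_linear.bounded[OF bounded_linear_phase_corr] by blast
    have "norm (phase_corr S (\<zeta>half (Suc l)) - \<zeta>half (Suc l))
        \<le> norm (amp_corr a (\<zeta> (Suc l)) - \<zeta> (Suc l)) * (K + 1)" for l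
    proof -
      define d where "d = amp_corr a (\<zeta> (Suc l)) - \<zeta> (Suc l)"
      have "phase_corr S d = phase_corr S (\<zeta>half (Suc l)) - \<zeta> (Suc l)"
        unfolding d_def half linear_diff[OF bounded_linear.linear[OF bounded_linear_phase_corr]]
        by (simp add: phase_corr_fixes_range[OF frame in_range])
      then have "phase_corr S (\<zeta>half (Suc l)) - \<zeta>half (Suc l) = phase_corr S d - d"
        by (simp add: d_def half)
      also have "norm \<dots> \<le> norm d * (K + 1)"
        using K[of d] norm_triangle_ineq4[of "phase_corr S d" d] by (simp add: distrib_left)
      finally show ?thesis by (simp add: d_def)
    qed
    note bound = this
    have "(\<lambda>l. norm (amp_corr a (\<zeta> (Suc l)) - \<zeta> (Suc l)) * (K + 1)) \<longlonglongrightarrow> 0"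
      using that unfolding c2_def by (intro tendsto_mult_left_zero LIMSEQ_Suc)
    then have "(\<lambda>l. norm (phase_corr S (\<zeta>half (Suc l)) - \<zeta>half (Suc l))) \<longlonglongrightarrow> 0"
      by (rule Lim_null_comparison[rotated]) (simp add: bound)
    then show ?thesis unfolding c3_def by (rule LIMSEQ_imp_Suc)
  qed

  have c3_c2: c2 if c3
  proof -
    have "norm (amp_corr a (\<zeta> (Suc l)) - \<zeta> (Suc l)) \<le> norm (phase_corr S (\<zeta>half l) - \<zeta>half l)" for l
      using norm_amp_corr_diff_le[of "\<zeta>half l" a "\<zeta> (Suc l)"] a_nonneg
      by (simp add: half step cmod_amp_corr norm_minus_commute)
    note bound = this
    have "(\<lambda>l. norm (amp_corr a (\<zeta> (Suc l)) - \<zeta> (Suc l))) \<longlonglongrightarrow> 0"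
      using that[unfolded c3_def] by (rule Lim_null_comparison[rotated]) (simp add: bound)
    then show ?thesis unfolding c2_def by (rule LIMSEQ_imp_Suc)
  qed

  have "c4" if c2 c3
  proof -
    have "norm (\<zeta> (Suc l) - \<zeta> l)
        \<le> norm (phase_corr S (\<zeta>half l) - \<zeta>half l) + norm (amp_corr a (\<zeta> l) - \<zeta> l)" for l
      using norm_triangle_ineq[of "\<zeta> (Suc l) - \<zeta>half l" "\<zeta>half l - \<zeta> l"] by (simp add: half step)
    note bound = this
    have "(\<lambda>l. norm (phase_corr S (\<zeta>half l) - \<zeta>half l) + norm (amp_corr a (\<zeta> l) - \<zeta> l)) \<longlonglongrightarrow> 0"
      using tendsto_add[OF that(2)[unfolded c3_def] that(1)[unfolded c2_def]] by simp
    then show ?thesis unfolding c4_def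
      by (rule Lim_null_comparison[rotated]) (simp add: bound)
  qed
  then show "c1 \<longleftrightarrow> c2" "c2 \<longleftrightarrow> c3" "c1 \<longrightarrow> c4"
    using c1_c2 c2_c1 c2_c3 c3_c2 by blast+
qed

theorem theorem3p18:
  assumes "CARD('n::finite) \<le> CARD('m::finite)"
    and "CARD('m) \<ge> 4 * CARD('n) - 2"
  shows "\<exists>W :: (complex^'m) set set.
    zariski_open TYPE('n) W \<and> W \<noteq> {} \<and>
    (\<forall>(S :: complex^'n^'m) (\<psi>\<^sub>0 :: complex^'n) (a :: real^'m) (U :: (complex^'m) set)
       (\<zeta> :: nat \<Rightarrow> complex^'m) (\<zeta>half :: nat \<Rightarrow> complex^'m).
       frame_matrix S \<longrightarrow> matrix_range S \<in> W \<longrightarrow>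
       a = cmod_vec (S *v \<psi>\<^sub>0) \<longrightarrow> (\<forall>i. a $ i \<noteq> 0) \<longrightarrow>
       open U \<longrightarrow> solution_set S \<psi>\<^sub>0 \<subseteq> U \<longrightarrow>
       U \<inter> AP_fixed_points S a = solution_set S \<psi>\<^sub>0 \<longrightarrow>
       \<zeta> 0 \<in> U \<longrightarrow>
       (\<forall>l. \<zeta>half l = amp_corr a (\<zeta> l)) \<longrightarrow>
       (\<forall>l. \<zeta> (Suc l) = phase_corr S (\<zeta>half l)) \<longrightarrow>
       (let c1 = ((\<lambda>l. infdist (\<zeta> l) (solution_set S \<psi>\<^sub>0)) \<longlonglongrightarrow> 0);
            c2 = ((\<lambda>l. norm (amp_corr a (\<zeta> l) - \<zeta> l)) \<longlonglongrightarrow> 0);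
            c3 = ((\<lambda>l. norm (phase_corr S (\<zeta>half l) - \<zeta>half l)) \<longlonglongrightarrow> 0);
            c4 = ((\<lambda>l. norm (\<zeta> (Suc l) - \<zeta> l)) \<longlonglongrightarrow> 0)
        in (c1 \<longleftrightarrow> c2) \<and> (c2 \<longleftrightarrow> c3) \<and> (c1 \<longrightarrow> c4)))"
proof -
  obtain q :: "complex^'n^'m \<Rightarrow> real" and S\<^sub>0 where q: "real_polynomial_function q" "q S\<^sub>0 \<noteq> 0"
    "\<And>S. q S \<noteq> 0 \<Longrightarrow> inj ((*v) S) \<and> \<not> ambiguous S"
    using generic_polynomial[OF assms(2)] by blast
  define W where "W = {matrix_range S | S. q S \<noteq> 0}"
  have open_W: "zariski_open TYPE('n) W" unfolding W_def
    by (rule zariski_open_nonvanishing[OF q(1)]) (use q(3) in blast)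
  have "W \<noteq> {}" using q(2) by (auto simp: W_def)
  have unambiguous: "\<exists>S' :: complex^'n^'m. \<not> ambiguous S' \<and> matrix_range S' = matrix_range S"
    if "matrix_range S \<in> W" for S :: "complex^'n^'m"
  proof -
    from that obtain S' where "matrix_range S = matrix_range S'" "q S' \<noteq> 0" by (auto simp: W_def)
    then show ?thesis using q(3) by (intro exI[of _ S']) simp
  qed
  \<comment> \<open>Phase retrieval depends on the range only, so one good matrix per range suffices.\<close>
  show ?thesis
    unfolding Let_def
  proof (intro exI[of _ W] conjI[OF open_W] conjI[OF \<open>W \<noteq> {}\<close>] allI impI, goal_cases)
    case (1 S \<psi>\<^sub>0 a U \<zeta> \<zeta>half)
    then obtain S' :: "complex^'n^'m" where S': "\<not> ambiguous S'" "matrix_range S' = matrix_range S"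
      using unambiguous by blast
    note AP = alternating_projection_conditions[OF \<open>frame_matrix S\<close> S' \<open>a = cmod_vec (S *v \<psi>\<^sub>0)\<close>, of \<zeta>half \<zeta>]
    from 1 show ?case by (intro conjI AP) auto
  qed
qed

end
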